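(* Let $F=(F_1,\dots,F_m)^\top:\mathbb{R}^n\to\mathbb{R}^m$ be twice continuously differentiable and let $x^0\in\mathbb{R}^n$. Let $\mathcal{L}=\{x\in\mathbb{R}^n: F_i(x)\le F_i(x^0)\ \text{for all } i\in\{1,\dots,m\}\}$. Assume: (A4) there are constants $a,b$ with $0<a\le1\le b$ such that $$a\|z\|^2\le z^\top\nabla^2F_i(x)z\le b\|z\|^2\quad\text{for all }x\in\mathcal{L},\ z\in\mathbb{R}^n,\ i\in\{1,\dots,m\}.$$ Let $\{x^k\}$ be the (infinite) sequence generated from $x^0$ by the MSD-I algorithm, and let $\bar x$ be a Pareto optimal limit point (accumulation point) of $\{x^k\}$, with associated multiplier vector $\bar\lambda=\lambda(\bar x)$. Then $\{x^k\}$ converges R-linearly to $\bar x$, i.e. there exist $C>0$ and $r\in(0,1)$ such that $\|x^k-\bar x\|\le C\,r^k$ for all $k$.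
   Context: A point $\bar x\in\mathbb{R}^n$ is Pareto optimal for $F$ if there is no $x\in\mathbb{R}^n$ with $F_i(x)\le F_i(\bar x)$ for all $i\in\{1,\dots,m\}$ and $F(x)\ne F(\bar x)$. $\|\cdot\|$ and $\langle\cdot,\cdot\rangle$ are the Euclidean norm and inner product. For $x,d\in\mathbb{R}^n$ let $\psi(x,d)=\max_{1\le i\le m}\langle\nabla F_i(x),d\rangle$. The steepest descent direction $v(x)$ is the unique minimizer over $d\in\mathbb{R}^n$ of $\psi(x,d)+\tfrac12\|d\|^2$; equivalently $v(x)=-\sum_{i=1}^m\lambda_i(x)\nabla F_i(x)$, where the multiplier vector $\lambda(x)$ is an optimal solution of $\min\{\tfrac12\|\sum_{i=1}^m\lambda_i\nabla F_i(x)\|^2:\ \lambda\in\mathbb{R}^m,\ \lambda_i\ge0,\ \sum_i\lambda_i=1\}$. MSD-I algorithm. Fix $\rho,\delta\in(0,1)$, an initial point $x^0\in\mathbb{R}^n$ and $\tau_0=1$. For $k=0,1,2,\dots$: 1. Compute an optimal solution $\lambda^k=\lambda(x^k)$ of $\min\{\tfrac12\|\sum_{i=1}^m\lambda_i\nabla F_i(x^k)\|^2:\ \lambda\in\mathbb{R}^m,\ \lambda_i\ge0,\ \sum_i\lambda_i=1\}$, and $v(x^k)=-\sum_i\lambda_i^k\nabla F_i(x^k)$. If $v(x^k)=0$, stop. 2. Set $d^k=\tau_k^{-1}v(x^k)$ and let $t_k$ be the largest value in $\{\delta^0,\delta^1,\delta^2,\dots\}$ such that $F_i(x^k+t_kd^k)\le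 F_i(x^k)+\rho\, t_k\,\psi(x^k,d^k)$ for all $i\in\{1,\dots,m\}$. 3. Set $x^{k+1}=x^k+t_kd^k$. 4. Set $$\tau_{k+1}=\frac{2\tau_k\left(\tau_k\sum_{i=1}^m\lambda_i^k\,(F_i(x^{k+1})-F_i(x^k))+t_k\|v(x^k)\|^2\right)}{t_k^2\|v(x^k)\|^2};$$ if this value is negative, replace it by $\tau_{k+1}=1$. Standing convention: $\tau_k>0$ for all $k$, so that the algorithm is well defined. The algorithm is assumed not to stop, so that the sequence is infinite. *)

theory Defs
  imports "HOL-Analysis.Analysis"
begin

definition grad :: "(real^'n \<Rightarrow> real) \<Rightarrow> real^'n \<Rightarrow> real^'n" where
  "grad f x = (THE g. GDERIV f x :> g)"

definition hess :: "(real^'n \<Rightarrow> real) \<Rightarrow> real^'n \<Rightarrow> real^'n^'n" where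
  "hess f x = jacobian (grad f) (at x)"

definition C2 :: "(real^'n \<Rightarrow> real) \<Rightarrow> bool" where
  "C2 f \<longleftrightarrow> (\<forall>x. f differentiable (at x)) \<and> (\<forall>x. grad f differentiable (at x)) \<and>
     continuous_on UNIV (hess f)"

definition C2_vec :: "(real^'n \<Rightarrow> real^'m) \<Rightarrow> bool" where
  "C2_vec F \<longleftrightarrow> (\<forall>i. C2 (\<lambda>x. F x $ i))"

definition level_set :: "(real^'n \<Rightarrow> real^'m) \<Rightarrow> real^'n \<Rightarrow> (real^'n) set" where
  "level_set F x0 = {x. \<forall>i. F x $ i \<le> F x0 $ i}"

definition pareto_optimal :: "(real^'n \<Rightarrow> real^'m) \<Rightarrow> real^'n \<Rightarrow> bool" where
  "pareto_optimal F xb \<longleftrightarrow> \<not> (\<exists>x. (\<forall>i. F x $ i \<le> F xb $ i) \<and> F x \<noteq> F xb)"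

definition psi :: "(real^'n \<Rightarrow> real^'m) \<Rightarrow> real^'n \<Rightarrow> real^'n \<Rightarrow> real" where
  "psi F x d = (MAX i\<in>UNIV. grad (\<lambda>y. F y $ i) x \<bullet> d)"

definition prob_simplex :: "(real^'m) set" where
  "prob_simplex = {lam. (\<forall>i. 0 \<le> lam $ i) \<and> (\<Sum>i\<in>UNIV. lam $ i) = 1}"

definition comb_grad :: "(real^'n \<Rightarrow> real^'m) \<Rightarrow> real^'n \<Rightarrow> real^'m \<Rightarrow> real^'n" where
  "comb_grad F x lam = (\<Sum>i\<in>UNIV. lam $ i *\<^sub>R grad (\<lambda>y. F y $ i) x)"

text \<open>The optimal multiplier need not be unique (although the resulting combined gradient is),
  hence a predicate rather than a function of \<open>x\<close>.\<close>

definition opt_multiplier :: "(real^'n \<Rightarrow> real^'m) \<Rightarrow> real^'n \<Rightarrow> real^'m \<Rightarrow> bool" where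
  "opt_multiplier F x lam \<longleftrightarrow> lam \<in> prob_simplex \<and>
     (\<forall>mu\<in>prob_simplex. (1/2) * (norm (comb_grad F x lam))\<^sup>2 \<le> (1/2) * (norm (comb_grad F x mu))\<^sup>2)"

text \<open>The steepest descent direction at \<open>x\<close>, computed from an optimal multiplier \<open>lam\<close>.\<close>

definition sd_dir :: "(real^'n \<Rightarrow> real^'m) \<Rightarrow> real^'n \<Rightarrow> real^'m \<Rightarrow> real^'n" where
  "sd_dir F x lam = - comb_grad F x lam"

definition armijo_steps ::
  "(real^'n \<Rightarrow> real^'m) \<Rightarrow> real \<Rightarrow> real \<Rightarrow> real^'n \<Rightarrow> real^'n \<Rightarrow> real set" where
  "armijo_steps F \<rho> \<delta> x d =
     {t \<in> range (\<lambda>j::nat. \<delta> ^ j). \<forall>i. F (x + t *\<^sub>R d) $ i \<le> F x $ i + \<rho> * t * psi F x d}"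

definition tau_formula ::
  "(real^'n \<Rightarrow> real^'m) \<Rightarrow> real^'m \<Rightarrow> real^'n \<Rightarrow> real^'n \<Rightarrow> real^'n \<Rightarrow> real \<Rightarrow> real \<Rightarrow> real" where
  "tau_formula F lam x x' v \<tau> t =
     2 * \<tau> * (\<tau> * (\<Sum>i\<in>UNIV. lam $ i * (F x' $ i - F x $ i)) + t * (norm v)\<^sup>2) / (t\<^sup>2 * (norm v)\<^sup>2)"

text \<open>An infinite (non-stopping) run: \<open>x\<close>, \<open>lam\<close>, \<open>\<tau>\<close>, \<open>t\<close> are the sequences of iterates,
  multipliers, scaling parameters and step sizes.\<close>

definition MSD_I_run ::
  "(real^'n \<Rightarrow> real^'m) \<Rightarrow> real \<Rightarrow> real \<Rightarrow> real^'n \<Rightarrow> (nat \<Rightarrow> real^'n) \<Rightarrow> (nat \<Rightarrow> real^'m) \<Rightarrow>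
   (nat \<Rightarrow> real) \<Rightarrow> (nat \<Rightarrow> real) \<Rightarrow> bool" where
  "MSD_I_run F \<rho> \<delta> x0 x lam \<tau> t \<longleftrightarrow>
     x 0 = x0 \<and> \<tau> 0 = 1 \<and>
     (\<forall>k. let v = sd_dir F (x k) (lam k); d = inverse (\<tau> k) *\<^sub>R v;
              T = armijo_steps F \<rho> \<delta> (x k) d;
              \<tau>' = tau_formula F (lam k) (x k) (x (Suc k)) v (\<tau> k) (t k)
          in opt_multiplier F (x k) (lam k) \<and> v \<noteq> 0 \<and>
             t k \<in> T \<and> (\<forall>s\<in>T. s \<le> t k) \<and>
             x (Suc k) = x k + t k *\<^sub>R d \<and>
             \<tau> (Suc k) = (if \<tau>' < 0 then 1 else \<tau>'))"

definition seq_limit_point :: "(nat \<Rightarrow> 'a::topological_space) \<Rightarrow> 'a \<Rightarrow> bool" where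
  "seq_limit_point x l \<longleftrightarrow> (\<exists>r::nat\<Rightarrow>nat. strict_mono r \<and> (x \<circ> r) \<longlonglongrightarrow> l)"

definition R_linear_convergent :: "(nat \<Rightarrow> 'a::real_normed_vector) \<Rightarrow> 'a \<Rightarrow> bool" where
  "R_linear_convergent x l \<longleftrightarrow> (\<exists>C>0. \<exists>r. 0 < r \<and> r < 1 \<and> (\<forall>k. norm (x k - l) \<le> C * r ^ k))"

end

theory Submission
  imports Defs
begin

text \<open>Write \<open>s\<close> for \<open>t / \<tau>\<close>, \<open>e\<close> for the error \<open>x - xbar\<close>, and let \<open>v\<close> be the steepest descent
  direction. Every component of \<open>F\<close> decreases by at least \<open>\<rho> s \<parallel>v\<parallel>\<^sup>2\<close> per step, so \<open>xbar\<close> is interior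
  to the level set and (A4) holds on a ball around it. In this ball strong convexity bounds
  the \<open>\<lambda>\<close>-weighted gap \<open>F x - F xbar\<close> by \<open>\<parallel>v\<parallel> \<parallel>e\<parallel> - a/2 \<parallel>e\<parallel>\<^sup>2\<close>. This gives \<open>\<parallel>e\<parallel> \<le> 2 \<parallel>v\<parallel> / a\<close> and
  also \<open>\<rho> s \<parallel>v\<parallel> \<le> \<parallel>e\<parallel>\<close>: however small \<open>\<tau>\<close> is, a step taken near \<open>xbar\<close> cannot leave the ball.
  (The level set itself need not be connected.) The merit function
  \<open>\<Phi> = \<Sum>\<^sub>i lambar\<^sub>i (F\<^sub>i x - F\<^sub>i xbar)\<close> lies between \<open>a/2 \<parallel>e\<parallel>\<^sup>2\<close> and \<open>b/2 \<parallel>e\<parallel>\<^sup>2\<close> because the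
  \<open>lambar\<close>-combination of gradients vanishes at \<open>xbar\<close>; hence the iterates remain near \<open>xbar\<close>.
  There \<open>\<tau> \<le> b\<close>, backtracking bounds \<open>s\<close> from below, and \<open>\<Phi>\<close> contracts geometrically.\<close>

section \<open>Gradients, Taylor expansion and curvature on convex sets\<close>

text \<open>Existence is Riesz representation by \<open>adjoint f' 1\<close>; uniqueness then makes
  the definite description in \<open>grad\<close> meaningful.\<close>

lemma GDERIV_grad:
  assumes "f differentiable (at x)"
  shows "GDERIV f x :> grad f x"
proof -
  obtain f' where f': "(f has_derivative f') (at x)"
    using assms unfolding differentiable_def by blast
  have lin: "linear f'"
    using f' by (rule has_derivative_linear)
  have "f' = (\<lambda>h. h \<bullet> adjoint f' 1)"
    by (simp add: fun_eq_iff adjoint_works[OF lin])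
  with f' have D: "GDERIV f x :> adjoint f' 1"
    unfolding gderiv_def by simp
  have "g = g'" if "GDERIV f x :> g" "GDERIV f x :> g'" for g g'
  proof -
    have "(\<lambda>h. h \<bullet> g) = (\<lambda>h. h \<bullet> g')"
      using that unfolding gderiv_def by (rule has_derivative_unique)
    then show ?thesis
      by (metis inner_commute vector_eq_rdot)
  qed
  with D show ?thesis
    unfolding grad_def by (metis (mono_tags, lifting) theI)
qed

lemma GDERIV_along_line:
  assumes "GDERIV f (x + s *\<^sub>R d) :> g"
  shows "DERIV (\<lambda>s. f (x + s *\<^sub>R d)) s :> g \<bullet> d"
proof -
  have "((\<lambda>s. x + s *\<^sub>R d) has_derivative (\<lambda>h. h *\<^sub>R d)) (at s)"
    by (auto intro!: derivative_eq_intros)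
  from has_derivative_compose[OF this assms[unfolded gderiv_def]] show ?thesis
    unfolding has_field_derivative_def by (simp add: inner_commute mult_commute_abs)
qed

text \<open>One-variable Maclaurin expansion with Lagrange remainder, applied to \<open>f\<close>
  along the segment from \<open>x\<close> to \<open>y\<close>.\<close>

lemma C2_second_order_Taylor:
  assumes f: "C2 f"
  obtains \<xi> where "0 < \<xi>" "\<xi> < 1"
    "f y = f x + grad f x \<bullet> (y - x)
       + ((y - x) \<bullet> (hess f (x + \<xi> *\<^sub>R (y - x)) *v (y - x))) / 2"
proof -
  define d where "d = y - x"
  define diff where "diff = (\<lambda>(m::nat) s. if m = 0 then f (x + s *\<^sub>R d)
    else if m = 1 then grad f (x + s *\<^sub>R d) \<bullet> d
    else d \<bullet> (hess f (x + s *\<^sub>R d) *v d))"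
  have line: "((\<lambda>s. x + s *\<^sub>R d) has_derivative (\<lambda>h. h *\<^sub>R d)) (at s)" for s
    by (auto intro!: derivative_eq_intros)
  have 0: "DERIV (\<lambda>s. f (x + s *\<^sub>R d)) s :> grad f (x + s *\<^sub>R d) \<bullet> d" for s
    using f GDERIV_grad GDERIV_along_line unfolding C2_def by blast
  have 1: "DERIV (\<lambda>s. grad f (x + s *\<^sub>R d) \<bullet> d) s :> d \<bullet> (hess f (x + s *\<^sub>R d) *v d)" for s
  proof -
    have "(grad f has_derivative (\<lambda>h. hess f (x + s *\<^sub>R d) *v h)) (at (x + s *\<^sub>R d))"
      using f jacobian_works unfolding C2_def hess_def by blast
    from has_derivative_inner_left[OF has_derivative_compose[OF line this], of d] show ?thesis
      unfolding has_field_derivative_def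
      by (simp add: inner_commute mult_commute_abs matrix_vector_mult_scaleR)
  qed
  have "\<forall>m s. m < 2 \<and> 0 \<le> s \<and> s \<le> 1 \<longrightarrow> DERIV (diff m) s :> diff (Suc m) s"
    using 0 1 by (auto simp: diff_def less_2_cases_iff)
  with Maclaurin[of 1 2 diff "diff 0"] obtain \<xi> where "0 < \<xi>" "\<xi> < 1"
    "diff 0 1 = (\<Sum>m<2. (diff m 0 / fact m) * 1 ^ m) + (diff 2 \<xi> / fact 2) * 1 ^ 2"
    by auto
  then show ?thesis
    by (intro that[of \<xi>]) (simp_all add: diff_def d_def numeral_2_eq_2)
qed

text \<open>The form in which (A4) enters all estimates: strong convexity and a quadratic upper
  bound. The set is a parameter so that a ball can replace the level set.\<close>

definition curvature_bounds ::
  "(real^'n \<Rightarrow> real^'m) \<Rightarrow> real \<Rightarrow> real \<Rightarrow> (real^'n) set \<Rightarrow> bool" where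
  "curvature_bounds F a b S \<longleftrightarrow> (\<forall>i. \<forall>x\<in>S. \<forall>y\<in>S.
     a / 2 * (norm (y - x))\<^sup>2 \<le> F y $ i - F x $ i - grad (\<lambda>u. F u $ i) x \<bullet> (y - x) \<and>
     F y $ i - F x $ i - grad (\<lambda>u. F u $ i) x \<bullet> (y - x) \<le> b / 2 * (norm (y - x))\<^sup>2)"

text \<open>Convexity keeps the intermediate Taylor point in \<open>S\<close>, where the Hessian
  bounds apply.\<close>

lemma curvature_bounds_hess:
  fixes F :: "real^'n \<Rightarrow> real^'m"
  assumes "C2_vec F" "convex S"
    and H: "\<And>y z i. y \<in> S \<Longrightarrow>
          a * (norm z)\<^sup>2 \<le> z \<bullet> (hess (\<lambda>u. F u $ i) y *v z) \<and>
          z \<bullet> (hess (\<lambda>u. F u $ i) y *v z) \<le> b * (norm z)\<^sup>2"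
  shows "curvature_bounds F a b S"
  unfolding curvature_bounds_def
proof (intro allI ballI)
  fix i x y assume "x \<in> S" "y \<in> S"
  have "C2 (\<lambda>u. F u $ i)"
    using assms(1) by (simp add: C2_vec_def)
  then obtain \<xi> where \<xi>: "0 < \<xi>" "\<xi> < 1"
    and eq: "F y $ i = F x $ i + grad (\<lambda>u. F u $ i) x \<bullet> (y - x)
      + ((y - x) \<bullet> (hess (\<lambda>u. F u $ i) (x + \<xi> *\<^sub>R (y - x)) *v (y - x))) / 2"
    by (rule C2_second_order_Taylor)
  have "(1 - \<xi>) *\<^sub>R x + \<xi> *\<^sub>R y \<in> S"
    using \<xi> \<open>x \<in> S\<close> \<open>y \<in> S\<close> \<open>convex S\<close> by (auto simp: convex_alt)
  then have "x + \<xi> *\<^sub>R (y - x) \<in> S"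
    by (simp add: algebra_simps)
  from H[OF this, of "y - x" i] eq show "a / 2 * (norm (y - x))\<^sup>2
      \<le> F y $ i - F x $ i - grad (\<lambda>u. F u $ i) x \<bullet> (y - x) \<and>
     F y $ i - F x $ i - grad (\<lambda>u. F u $ i) x \<bullet> (y - x) \<le> b / 2 * (norm (y - x))\<^sup>2"
    by auto
qed

section \<open>Averaging over the simplex\<close>

lemma prob_simplex_sum_mono:
  fixes f g :: "'m::finite \<Rightarrow> real"
  assumes "mu \<in> prob_simplex" "\<And>i. f i \<le> g i"
  shows "(\<Sum>i\<in>UNIV. mu $ i * f i) \<le> (\<Sum>i\<in>UNIV. mu $ i * g i)"
  using assms by (intro sum_mono mult_left_mono) (auto simp: prob_simplex_def)

lemma prob_simplex_sum_const:
  fixes c :: real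
  assumes "mu \<in> prob_simplex"
  shows "(\<Sum>i\<in>UNIV. mu $ i * c) = c"
  using assms by (simp add: prob_simplex_def flip: sum_distrib_right)

lemma inner_comb_grad:
  "comb_grad F x mu \<bullet> d = (\<Sum>i\<in>UNIV. mu $ i * (grad (\<lambda>u. F u $ i) x \<bullet> d))"
  by (simp add: comb_grad_def inner_sum_left)

lemma curvature_bounds_weighted:
  fixes F :: "real^'n \<Rightarrow> real^'m"
  assumes "curvature_bounds F a b S" "x \<in> S" "y \<in> S" "mu \<in> prob_simplex"
  shows "a / 2 * (norm (y - x))\<^sup>2
           \<le> (\<Sum>i\<in>UNIV. mu $ i * (F y $ i - F x $ i)) - comb_grad F x mu \<bullet> (y - x)" (is "?l \<le> ?m")
    and "(\<Sum>i\<in>UNIV. mu $ i * (F y $ i - F x $ i)) - comb_grad F x mu \<bullet> (y - x)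
           \<le> b / 2 * (norm (y - x))\<^sup>2" (is "_ \<le> ?u")
proof -
  let ?f = "\<lambda>i. F y $ i - F x $ i - grad (\<lambda>u. F u $ i) x \<bullet> (y - x)"
  have eq: "?m = (\<Sum>i\<in>UNIV. mu $ i * ?f i)"
    by (simp add: inner_comb_grad right_diff_distrib sum_subtractf)
  have "?l \<le> ?f i" "?f i \<le> ?u" for i
    using assms(1-3) by (auto simp: curvature_bounds_def)
  then show "?l \<le> ?m" "?m \<le> ?u"
    using prob_simplex_sum_mono[OF assms(4), of "\<lambda>_. ?l" ?f]
      prob_simplex_sum_mono[OF assms(4), of ?f "\<lambda>_. ?u"]
    unfolding eq prob_simplex_sum_const[OF assms(4)] by blast+
qed

section \<open>Steepest descent direction and Pareto points\<close>

text \<open>Variational inequality for the minimum-norm point of the convex hull of the gradients: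
  moving \<open>lam\<close> slightly towards a vertex of the simplex cannot shorten the combined
  gradient.\<close>

lemma opt_multiplier_grad_le:
  fixes F :: "real^'n \<Rightarrow> real^'m"
  assumes "opt_multiplier F x lam"
  shows "grad (\<lambda>u. F u $ i) x \<bullet> sd_dir F x lam \<le> - (norm (sd_dir F x lam))\<^sup>2"
proof -
  let ?g = "comb_grad F x lam" and ?w = "grad (\<lambda>u. F u $ i) x - comb_grad F x lam"
  have simplex: "lam \<in> prob_simplex"
    using assms by (simp add: opt_multiplier_def)
  have le: "0 \<le> 2 * (?g \<bullet> ?w) + \<epsilon> * (?w \<bullet> ?w)" if \<epsilon>: "0 < \<epsilon>" "\<epsilon> < 1" for \<epsilon>
  proof -
    define mu where "mu = (1 - \<epsilon>) *\<^sub>R lam + \<epsilon> *\<^sub>R axis i 1"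
    have sum_axis: "(\<Sum>j\<in>UNIV. axis i (1::real) $ j) = 1"
      by (simp add: axis_def)
    have "(\<Sum>j\<in>UNIV. mu $ j) = 1"
      using simplex sum_axis
      by (simp add: mu_def prob_simplex_def sum.distrib flip: sum_distrib_left)
    moreover have "0 \<le> mu $ j" for j
      using simplex \<epsilon> by (simp add: mu_def prob_simplex_def axis_def)
    ultimately have "mu \<in> prob_simplex"
      by (simp add: prob_simplex_def)
    then have "(norm ?g)\<^sup>2 \<le> (norm (comb_grad F x mu))\<^sup>2"
      using assms by (auto simp: opt_multiplier_def)
    also have "comb_grad F x mu = ?g + \<epsilon> *\<^sub>R ?w"
    proof -
      have "(\<Sum>j\<in>UNIV. (axis i (1::real) $ j) *\<^sub>R grad (\<lambda>u. F u $ j) x) = grad (\<lambda>u. F u $ i) x"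
        by (simp add: axis_def if_distrib[of "\<lambda>c. c *\<^sub>R _"] cong: if_cong)
      then have "comb_grad F x mu = (1 - \<epsilon>) *\<^sub>R ?g + \<epsilon> *\<^sub>R grad (\<lambda>u. F u $ i) x"
        by (simp add: comb_grad_def mu_def scaleR_left_distrib sum.distrib
            flip: scaleR_scaleR scaleR_sum_right)
      then show ?thesis
        by (simp add: algebra_simps)
    qed
    finally have "0 \<le> \<epsilon> * (2 * (?g \<bullet> ?w) + \<epsilon> * (?w \<bullet> ?w))"
      by (simp add: power2_norm_eq_inner inner_add_left inner_add_right inner_commute algebra_simps)
    then show ?thesis
      using \<epsilon> by (simp add: zero_le_mult_iff)
  qed
  \<comment> \<open>Letting \<epsilon> tend to 0 removes the quadratic term and leaves the
    first-order condition.\<close>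
  have "((\<lambda>\<epsilon>. 2 * (?g \<bullet> ?w) + \<epsilon> * (?w \<bullet> ?w)) \<longlongrightarrow> 2 * (?g \<bullet> ?w) + 0 * (?w \<bullet> ?w)) (at_right 0)"
    by (intro tendsto_intros)
  moreover have "\<forall>\<^sub>F \<epsilon> in at_right 0. 0 \<le> 2 * (?g \<bullet> ?w) + \<epsilon> * (?w \<bullet> ?w)"
    using le by (auto simp: eventually_at_right_field intro!: exI[of _ 1])
  ultimately have "0 \<le> 2 * (?g \<bullet> ?w) + 0 * (?w \<bullet> ?w)"
    by (intro tendsto_lowerbound) auto
  then show ?thesis
    by (simp add: sd_dir_def power2_norm_eq_inner inner_diff_right inner_commute)
qed

lemma psi_upper_bound:
  assumes "\<And>i. grad (\<lambda>y. F y $ i) x \<bullet> d \<le> c"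
  shows "psi F x d \<le> c"
  unfolding psi_def by (subst Max_le_iff) (use assms in auto)

lemma grad_le_psi: "grad (\<lambda>y. F y $ i) x \<bullet> d \<le> psi F x d"
  unfolding psi_def by (intro Max_ge) auto

text \<open>Turns the Armijo test for a scaled direction into a decrease proportional to the squared
  norm of the unscaled one.\<close>

lemma opt_multiplier_psi_le:
  assumes "opt_multiplier F x lam" "0 \<le> c"
  shows "psi F x (c *\<^sub>R sd_dir F x lam) \<le> - c * (norm (sd_dir F x lam))\<^sup>2"
proof (rule psi_upper_bound)
  fix i
  show "grad (\<lambda>y. F y $ i) x \<bullet> (c *\<^sub>R sd_dir F x lam) \<le> - c * (norm (sd_dir F x lam))\<^sup>2"
    using mult_left_mono[OF opt_multiplier_grad_le[OF assms(1), of i] assms(2)] by simp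
qed

text \<open>A nonzero direction would have negative slope in every component; since there are
  finitely many, one small step would decrease them all.\<close>

lemma pareto_optimal_sd_dir_eq_0:
  fixes F :: "real^'n \<Rightarrow> real^'m"
  assumes diff: "\<And>i. (\<lambda>u. F u $ i) differentiable (at x)"
    and pareto: "pareto_optimal F x" and opt: "opt_multiplier F x lam"
  shows "sd_dir F x lam = 0"
proof (rule ccontr)
  define v where "v = sd_dir F x lam"
  assume "sd_dir F x lam \<noteq> 0"
  then have v: "v \<noteq> 0"
    by (simp add: v_def)
  have "\<forall>\<^sub>F h in at_right 0. F (x + h *\<^sub>R v) $ i < F x $ i" for i
  proof -
    have "DERIV (\<lambda>s. F (x + s *\<^sub>R v) $ i) 0 :> grad (\<lambda>u. F u $ i) x \<bullet> v"
      using GDERIV_along_line[where s = 0 and f = "\<lambda>u. F u $ i"] GDERIV_grad[OF diff] by simp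
    moreover have "grad (\<lambda>u. F u $ i) x \<bullet> v < 0"
      using opt_multiplier_grad_le[OF opt, of i] v unfolding v_def
      by (smt (verit) zero_less_norm_iff zero_less_power)
    ultimately obtain d where "d > 0" "\<And>h. 0 < h \<Longrightarrow> h < d \<Longrightarrow> F (x + h *\<^sub>R v) $ i < F x $ i"
      using DERIV_neg_dec_right[of "\<lambda>s. F (x + s *\<^sub>R v) $ i" _ 0] by auto
    then show ?thesis
      unfolding eventually_at_right_field by blast
  qed
  then have "\<forall>\<^sub>F h in at_right 0. \<forall>i. F (x + h *\<^sub>R v) $ i < F x $ i"
    by (rule eventually_all_finite)
  then obtain h where h: "\<And>i. F (x + h *\<^sub>R v) $ i < F x $ i"
    using eventually_happens'[OF trivial_limit_at_right_real] by blast
  then have "F (x + h *\<^sub>R v) \<noteq> F x"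
    by (metis less_irrefl)
  with h show False
    using pareto less_imp_le unfolding pareto_optimal_def by blast
qed

section \<open>Local estimates for gaps, errors and steps\<close>

text \<open>The weighted expansion at \<open>xbar\<close> has no linear term, so the gap is purely
  quadratic.\<close>

lemma pareto_gap_bounds:
  fixes F :: "real^'n \<Rightarrow> real^'m"
  assumes "curvature_bounds F a b S" "x \<in> S" "xbar \<in> S" "mu \<in> prob_simplex"
    and "comb_grad F xbar mu = 0"
  shows "a / 2 * (norm (x - xbar))\<^sup>2 \<le> (\<Sum>i\<in>UNIV. mu $ i * (F x $ i - F xbar $ i))"
    and "(\<Sum>i\<in>UNIV. mu $ i * (F x $ i - F xbar $ i)) \<le> b / 2 * (norm (x - xbar))\<^sup>2"
  using curvature_bounds_weighted[OF assms(1,3,2,4)] assms(5) by auto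

text \<open>Strong convexity expanded at \<open>x\<close>, with Cauchy-Schwarz applied to the linear
  term.\<close>

lemma weighted_gap_le:
  fixes F :: "real^'n \<Rightarrow> real^'m"
  assumes "curvature_bounds F a b S" "x \<in> S" "y \<in> S" "lam \<in> prob_simplex"
  shows "(\<Sum>i\<in>UNIV. lam $ i * (F x $ i - F y $ i)) + a / 2 * (norm (x - y))\<^sup>2
     \<le> norm (sd_dir F x lam) * norm (x - y)"
proof -
  have "(\<Sum>i\<in>UNIV. lam $ i * (F y $ i - F x $ i)) = - (\<Sum>i\<in>UNIV. lam $ i * (F x $ i - F y $ i))"
    by (simp add: sum_negf[symmetric] algebra_simps)
  moreover have "sd_dir F x lam \<bullet> (y - x) \<le> norm (sd_dir F x lam) * norm (x - y)"
    using norm_cauchy_schwarz[of "sd_dir F x lam" "y - x"] by (simp add: norm_minus_commute)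
  ultimately show ?thesis
    using curvature_bounds_weighted(1)[OF assms] by (simp add: sd_dir_def norm_minus_commute)
qed

lemma error_bound:
  fixes F :: "real^'n \<Rightarrow> real^'m"
  assumes "curvature_bounds F a b S" "x \<in> S" "y \<in> S" "lam \<in> prob_simplex"
    and "\<And>i. F y $ i \<le> F x $ i"
  shows "a * norm (x - y) \<le> 2 * norm (sd_dir F x lam)"
proof (cases "x = y")
  case False
  have "0 \<le> (\<Sum>i\<in>UNIV. lam $ i * (F x $ i - F y $ i))"
    using prob_simplex_sum_mono[OF assms(4), of "\<lambda>_. 0"] assms(5) by simp
  then have "norm (x - y) * (a * norm (x - y)) \<le> norm (x - y) * (2 * norm (sd_dir F x lam))"
    using weighted_gap_le[OF assms(1-4)] by (simp add: power2_eq_square algebra_simps)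
  then show ?thesis
    using False by simp
qed simp

text \<open>The gap is at least \<open>c * (norm v)\<^sup>2\<close> and at most
  \<open>norm v\<close> times the distance. With \<open>c\<close> a multiple of the step length,
  this limits steps without any lower bound on \<open>\<tau>\<close>.\<close>

lemma step_le_error:
  fixes F :: "real^'n \<Rightarrow> real^'m"
  assumes "curvature_bounds F a b S" "x \<in> S" "y \<in> S" "lam \<in> prob_simplex" "0 \<le> a"
    and v: "v = sd_dir F x lam" "v \<noteq> 0"
    and "\<And>i. F y $ i \<le> F x $ i - c * (norm v)\<^sup>2"
  shows "c * norm v \<le> norm (x - y)"
proof -
  have "c * (norm v)\<^sup>2 \<le> (\<Sum>i\<in>UNIV. lam $ i * (F x $ i - F y $ i))"
    using prob_simplex_sum_mono[OF assms(4), of "\<lambda>_. c * (norm v)\<^sup>2" "\<lambda>i. F x $ i - F y $ i"]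
      assms(8)
    unfolding prob_simplex_sum_const[OF assms(4)] by (simp add: algebra_simps)
  also have "\<dots> \<le> norm v * norm (x - y)"
    using weighted_gap_le[OF assms(1-4)] \<open>0 \<le> a\<close> v(1) by (smt (verit) divide_nonneg_nonneg mult_nonneg_nonneg zero_le_power2)
  finally have "norm v * (c * norm v) \<le> norm v * norm (x - y)"
    by (simp add: power2_eq_square algebra_simps)
  then show ?thesis
    using v(2) by simp
qed

text \<open>With \<open>s = t / \<tau>\<close>, the formula is twice the \<open>lam\<close>-weighted
  second-order remainder divided by the squared length of the step \<open>s *\<^sub>R v\<close>,
  hence a curvature along that step.\<close>

lemma tau_formula_le:
  fixes F :: "real^'n \<Rightarrow> real^'m"
  assumes "curvature_bounds F a b S" "x \<in> S" "x + (t / \<tau>) *\<^sub>R v \<in> S" "lam \<in> prob_simplex"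
    and v: "v = sd_dir F x lam" "v \<noteq> 0" and pos: "0 < t" "0 < \<tau>"
  shows "tau_formula F lam x (x + (t / \<tau>) *\<^sub>R v) v \<tau> t \<le> b"
proof -
  let ?D = "\<Sum>i\<in>UNIV. lam $ i * (F (x + (t / \<tau>) *\<^sub>R v) $ i - F x $ i)"
  have "?D + t / \<tau> * (norm v)\<^sup>2 \<le> b / 2 * ((t / \<tau>)\<^sup>2 * (norm v)\<^sup>2)"
  proof -
    have "comb_grad F x lam = - v"
      by (simp add: v sd_dir_def)
    then show ?thesis
      using curvature_bounds_weighted(2)[OF assms(1-4)]
      by (simp add: dot_square_norm power_mult_distrib power_divide)
  qed
  then have "2 * \<tau>\<^sup>2 * (?D + t / \<tau> * (norm v)\<^sup>2) \<le> 2 * \<tau>\<^sup>2 * (b / 2 * ((t / \<tau>)\<^sup>2 * (norm v)\<^sup>2))"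
    by (intro mult_left_mono) auto
  also have "\<dots> = b * (t\<^sup>2 * (norm v)\<^sup>2)"
    using pos by (simp add: power_divide)
  also have "2 * \<tau>\<^sup>2 * (?D + t / \<tau> * (norm v)\<^sup>2) = 2 * \<tau> * (\<tau> * ?D + t * (norm v)\<^sup>2)"
    using pos by (simp add: field_simps power2_eq_square)
  finally show ?thesis
    unfolding tau_formula_def using pos v by (subst pos_divide_le_eq) auto
qed

text \<open>The quadratic upper bound guarantees the Armijo test for short steps, so a rejected
  trial must be long.\<close>

lemma armijo_rejected_step:
  fixes F :: "real^'n \<Rightarrow> real^'m"
  assumes "curvature_bounds F a b S" "x \<in> S" "x + (s / \<tau>) *\<^sub>R v \<in> S"
    and opt: "opt_multiplier F x lam" and v: "v = sd_dir F x lam" "v \<noteq> 0"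
    and pos: "0 < s" "0 < \<tau>" "0 < b" and \<rho>: "\<rho> < 1"
    and rej: "\<not> F (x + s *\<^sub>R (inverse \<tau> *\<^sub>R v)) $ i
                \<le> F x $ i + \<rho> * s * psi F x (inverse \<tau> *\<^sub>R v)"
  shows "2 * (1 - \<rho>) / b \<le> s / \<tau>"
proof -
  define p where "p = psi F x (inverse \<tau> *\<^sub>R v)"
  define c where "c = s / \<tau>"
  have c: "c > 0" "s *\<^sub>R (inverse \<tau> *\<^sub>R v) = c *\<^sub>R v"
    using pos by (auto simp: c_def divide_inverse)
  have p: "p \<le> - inverse \<tau> * (norm v)\<^sup>2"
    using opt_multiplier_psi_le[OF opt, of "inverse \<tau>"] pos unfolding p_def v by simp
  have "grad (\<lambda>u. F u $ i) x \<bullet> (c *\<^sub>R v) = s * (grad (\<lambda>u. F u $ i) x \<bullet> (inverse \<tau> *\<^sub>R v))"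
    by (simp add: c_def divide_inverse)
  also have "\<dots> \<le> s * p"
    unfolding p_def using pos by (intro mult_left_mono[OF grad_le_psi]) simp
  finally have g: "grad (\<lambda>u. F u $ i) x \<bullet> (c *\<^sub>R v) \<le> s * p" .
  have "F (x + c *\<^sub>R v) $ i - F x $ i - grad (\<lambda>u. F u $ i) x \<bullet> (x + c *\<^sub>R v - x)
      \<le> b / 2 * (norm (x + c *\<^sub>R v - x))\<^sup>2"
    using assms(1-3) unfolding curvature_bounds_def c_def by blast
  then have "F (x + c *\<^sub>R v) $ i \<le> F x $ i + s * p + b / 2 * (c\<^sup>2 * (norm v)\<^sup>2)"
    using g by (simp add: power_mult_distrib)
  then have "(1 - \<rho>) * (s * - p) \<le> b / 2 * (c\<^sup>2 * (norm v)\<^sup>2)"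
    using rej unfolding c(2) p_def[symmetric] by (simp add: algebra_simps)
  \<comment> \<open>Replacing \<open>p\<close> by its bound makes both sides multiples of
    \<open>c * (norm v)\<^sup>2\<close>, which can be cancelled.\<close>
  moreover have "(1 - \<rho>) * (c * (norm v)\<^sup>2) \<le> (1 - \<rho>) * (s * - p)"
    using p \<rho> pos mult_left_mono[OF p, of s] by (intro mult_left_mono) (auto simp: c_def divide_inverse mult.assoc)
  ultimately have "(c * (norm v)\<^sup>2) * (2 * (1 - \<rho>)) \<le> (c * (norm v)\<^sup>2) * (b * c)"
    by (simp add: power2_eq_square algebra_simps)
  then have "2 * (1 - \<rho>) \<le> b * c"
    by (rule mult_left_le_imp_le) (use c v in simp)
  then show ?thesis
    using pos by (simp add: c_def[symmetric] pos_divide_le_eq mult.commute)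
qed

section \<open>From a contracting merit function to an R-linear rate\<close>

lemma R_linear_convergentI:
  fixes x :: "nat \<Rightarrow> 'a::real_normed_vector" and \<Phi> :: "nat \<Rightarrow> real"
  assumes e: "\<And>k. k \<ge> N \<Longrightarrow> (norm (x k - l))\<^sup>2 \<le> M * \<Phi> k"
    and q: "\<And>k. k \<ge> N \<Longrightarrow> \<Phi> (Suc k) \<le> q * \<Phi> k" "q < 1" and M: "0 < M"
  shows "R_linear_convergent x l"
proof -
  \<comment> \<open>The factor \<open>q\<close> may be nonpositive, while the rate must be positive.
    The square root then passes from squared errors to errors.\<close>
  define p where "p = max q (1 / 2)"
  define r where "r = sqrt p"
  have p: "0 < p" "p < 1"
    using q by (auto simp: p_def)
  then have r: "0 < r" "r < 1" "r\<^sup>2 = p"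
    by (auto simp: r_def)
  have \<Phi>_ge: "0 \<le> \<Phi> k" if "k \<ge> N" for k
  proof -
    have "0 \<le> M * \<Phi> k"
      using e[OF that] order_trans zero_le_power2 by blast
    then show ?thesis
      using M by (simp add: zero_le_mult_iff)
  qed
  have \<Phi>: "\<Phi> (N + j) \<le> \<Phi> N * p ^ j" for j
  proof (induction j)
    case (Suc j)
    have "\<Phi> (N + Suc j) \<le> q * \<Phi> (N + j)"
      using q(1)[of "N + j"] by simp
    also have "\<dots> \<le> p * \<Phi> (N + j)"
      using \<Phi>_ge by (intro mult_right_mono) (auto simp: p_def)
    also have "\<dots> \<le> p * (\<Phi> N * p ^ j)"
      using Suc p by (intro mult_left_mono) auto
    finally show ?case
      by (simp add: algebra_simps)
  qed simp
  \<comment> \<open>\<open>A\<close> handles the tail, with \<open>p ^ N\<close> correcting the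
    index shift; \<open>B\<close> covers the first \<open>N\<close> iterates.\<close>
  define A where "A = sqrt (M * \<Phi> N / p ^ N)"
  define B where "B = (\<Sum>j<N. norm (x j - l) / r ^ j)"
  have A: "0 \<le> A" and B: "0 \<le> B"
    using \<Phi>_ge[of N] M p r by (auto simp: A_def B_def intro!: sum_nonneg)
  have "norm (x k - l) \<le> (1 + A + B) * r ^ k" for k
  proof (cases "k < N")
    case True
    then have "norm (x k - l) / r ^ k \<le> B"
      unfolding B_def using r by (intro member_le_sum) auto
    then have "norm (x k - l) \<le> B * r ^ k"
      using r by (simp add: pos_divide_le_eq)
    also have "\<dots> \<le> (1 + A + B) * r ^ k"
      using A r by (intro mult_right_mono) auto
    finally show ?thesis .
  next
    case False
    then obtain j where k: "k = N + j"
      using le_Suc_ex not_less by blast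
    have "(norm (x k - l))\<^sup>2 \<le> M * (\<Phi> N * p ^ j)"
      using e[of k] \<Phi>[of j] M k by (smt (verit) False mult_left_mono not_less)
    also have "\<dots> = (M * \<Phi> N / p ^ N) * p ^ k"
      using p by (simp add: k power_add)
    also have "\<dots> = (A * r ^ k)\<^sup>2"
    proof -
      have "A\<^sup>2 = M * \<Phi> N / p ^ N"
        unfolding A_def using \<Phi>_ge[of N] M p by simp
      then show ?thesis
        by (simp add: power_mult_distrib r(3) flip: power_mult mult.commute[of 2 k])
          (simp add: power_mult r(3))
    qed
    finally have "norm (x k - l) \<le> A * r ^ k"
      using A r by (meson mult_nonneg_nonneg power2_le_imp_le less_imp_le zero_le_power)
    also have "\<dots> \<le> (1 + A + B) * r ^ k"
      using B r by (intro mult_right_mono) auto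
    finally show ?thesis .
  qed
  moreover have "0 < 1 + A + B"
    using A B by simp
  ultimately show ?thesis
    unfolding R_linear_convergent_def using r by blast
qed

theorem theorem3p2:
  fixes F :: "real^'n \<Rightarrow> real^'m"
    and \<rho> \<delta> a b :: real
    and x0 xbar :: "real^'n"
    and x :: "nat \<Rightarrow> real^'n"
    and lam :: "nat \<Rightarrow> real^'m"
    and lambar :: "real^'m"
    and \<tau> t :: "nat \<Rightarrow> real"
  assumes smooth: "C2_vec F"
    and ab: "0 < a" "a \<le> 1" "1 \<le> b"
    and A4: "\<And>y z i. y \<in> level_set F x0 \<Longrightarrow>
          a * (norm z)\<^sup>2 \<le> z \<bullet> (hess (\<lambda>u. F u $ i) y *v z) \<and>
          z \<bullet> (hess (\<lambda>u. F u $ i) y *v z) \<le> b * (norm z)\<^sup>2"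
    and \<rho>: "0 < \<rho>" "\<rho> < 1"
    and \<delta>: "0 < \<delta>" "\<delta> < 1"
    and run: "MSD_I_run F \<rho> \<delta> x0 x lam \<tau> t"
    and \<tau>_pos: "\<And>k. \<tau> k > 0"
    and limpt: "seq_limit_point x xbar"
    and pareto: "pareto_optimal F xbar"
    and lambar: "opt_multiplier F xbar lambar"
  shows "R_linear_convergent x xbar"
proof -
  define v where "v = (\<lambda>k. sd_dir F (x k) (lam k))"
  define s where "s = (\<lambda>k. t k / \<tau> k)"
  define e where "e = (\<lambda>k. norm (x k - xbar))"
  define \<Phi> where "\<Phi> = (\<lambda>k. \<Sum>i\<in>UNIV. lambar $ i * (F (x k) $ i - F xbar $ i))"

  \<comment> \<open>Descent along the run\<close>
  have run_k: "opt_multiplier F (x k) (lam k)" "v k \<noteq> 0"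
    "t k \<in> armijo_steps F \<rho> \<delta> (x k) (inverse (\<tau> k) *\<^sub>R v k)"
    "\<And>r. r \<in> armijo_steps F \<rho> \<delta> (x k) (inverse (\<tau> k) *\<^sub>R v k) \<Longrightarrow> r \<le> t k"
    "x (Suc k) = x k + t k *\<^sub>R (inverse (\<tau> k) *\<^sub>R v k)"
    "\<tau> (Suc k) \<le> max 1 (tau_formula F (lam k) (x k) (x (Suc k)) (v k) (\<tau> k) (t k))" for k
    using run unfolding MSD_I_run_def Let_def v_def by auto
  have x0: "x 0 = x0"
    using run unfolding MSD_I_run_def by simp
  have lam: "lam k \<in> prob_simplex" for k
    using run_k(1) by (simp add: opt_multiplier_def)
  have t_pos: "0 < t k" for k
    using run_k(3)[of k] \<delta> by (auto simp: armijo_steps_def)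
  have s_pos: "0 < s k" for k
    using t_pos \<tau>_pos by (simp add: s_def)
  have x_Suc: "x (Suc k) = x k + s k *\<^sub>R v k" for k
    using run_k(5) by (simp add: s_def divide_inverse)
  have decrease: "F (x (Suc k)) $ i \<le> F (x k) $ i - \<rho> * s k * (norm (v k))\<^sup>2" for k i
  proof -
    have "F (x (Suc k)) $ i \<le> F (x k) $ i + \<rho> * t k * psi F (x k) (inverse (\<tau> k) *\<^sub>R v k)"
      using run_k(3)[of k] unfolding run_k(5) by (simp add: armijo_steps_def)
    also have "\<dots> \<le> F (x k) $ i + \<rho> * t k * (- inverse (\<tau> k) * (norm (v k))\<^sup>2)"
      using opt_multiplier_psi_le[OF run_k(1), of "inverse (\<tau> k)"] \<rho> t_pos[of k] \<tau>_pos[of k]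
      unfolding v_def by (intro add_left_mono mult_left_mono) auto
    finally show ?thesis
      by (simp add: s_def divide_inverse algebra_simps)
  qed
  have strict: "F (x (Suc k)) $ i < F (x k) $ i" for k i
  proof -
    have "0 < \<rho> * s k * (norm (v k))\<^sup>2"
      using \<rho> s_pos run_k(2) by simp
    with decrease[of k i] show ?thesis
      by simp
  qed

  \<comment> \<open>Convergence of the function values\<close>
  have diff: "(\<lambda>u. F u $ i) differentiable (at y)" for i y
    using smooth by (simp add: C2_vec_def C2_def)
  have cont: "isCont (\<lambda>u. F u $ i) y" for i y
    using diff by (rule differentiable_imp_continuous_within)
  obtain r where r: "strict_mono r" "(x \<circ> r) \<longlonglongrightarrow> xbar"
    using limpt by (auto simp: seq_limit_point_def)
  have antimono: "decseq (\<lambda>k. F (x k) $ i)" for i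
    using strict by (intro decseq_SucI less_imp_le)
  have sub_lim: "(\<lambda>k. F (x (r k)) $ i) \<longlonglongrightarrow> F xbar $ i" for i
    using isCont_tendsto_compose[OF cont r(2)] by (simp add: o_def)
  have xbar_le: "F xbar $ i \<le> F (x k) $ i" for i k
  proof (rule LIMSEQ_le_const2[OF sub_lim])
    show "\<exists>N. \<forall>n\<ge>N. F (x (r n)) $ i \<le> F (x k) $ i"
      using decseqD[OF antimono] seq_suble[OF r(1)] le_trans by blast
  qed
  \<comment> \<open>A bounded monotone sequence converges as a whole; the subsequence identifies its
    limit.\<close>
  have F_lim: "(\<lambda>k. F (x k) $ i) \<longlonglongrightarrow> F xbar $ i" for i
  proof -
    obtain L where L: "(\<lambda>k. F (x k) $ i) \<longlonglongrightarrow> L"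
      using decseq_convergent[OF antimono, of "F xbar $ i" i] xbar_le by blast
    then have "(\<lambda>k. F (x (r k)) $ i) \<longlonglongrightarrow> L"
      using LIMSEQ_subseq_LIMSEQ[OF L r(1)] by (simp add: o_def)
    with L show ?thesis
      using LIMSEQ_unique sub_lim by blast
  qed

  \<comment> \<open>Estimates on a ball inside the level set\<close>
  have "F xbar $ i < F x0 $ i" for i
    using xbar_le[of i 1] strict[of 0 i] by (simp add: x0)
  moreover have "open {y. \<forall>i. F y $ i < F x0 $ i}"
  proof -
    have "{y. \<forall>i. F y $ i < F x0 $ i} = (\<Inter>i. {y. F y $ i < F x0 $ i})"
      by auto
    also have "open \<dots>"
      using cont by (intro open_INT open_Collect_less continuous_on_const
          continuous_at_imp_continuous_on ballI) auto
    finally show ?thesis .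
  qed
  ultimately obtain R where R: "0 < R" "ball xbar R \<subseteq> {y. \<forall>i. F y $ i < F x0 $ i}"
    using openE[of "{y. \<forall>i. F y $ i < F x0 $ i}" xbar] by blast
  have S: "curvature_bounds F a b (ball xbar R)"
  proof (rule curvature_bounds_hess[OF smooth convex_ball])
    fix y z i assume "y \<in> ball xbar R"
    then have "y \<in> level_set F x0"
      using R by (auto simp: level_set_def less_imp_le)
    then show "a * (norm z)\<^sup>2 \<le> z \<bullet> (hess (\<lambda>u. F u $ i) y *v z) \<and>
        z \<bullet> (hess (\<lambda>u. F u $ i) y *v z) \<le> b * (norm z)\<^sup>2"
      by (rule A4)
  qed
  have xbar_S: "xbar \<in> ball xbar R"
    using R by simp
  have mem_S: "x k \<in> ball xbar R \<longleftrightarrow> e k < R" for k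
    by (simp add: e_def dist_norm norm_minus_commute)
  have lambar_simplex: "lambar \<in> prob_simplex"
    using lambar by (simp add: opt_multiplier_def)
  have crit: "comb_grad F xbar lambar = 0"
    using pareto_optimal_sd_dir_eq_0[OF diff pareto lambar] by (simp add: sd_dir_def)
  have \<Phi>_lower: "a / 2 * (e k)\<^sup>2 \<le> \<Phi> k" and \<Phi>_upper: "\<Phi> k \<le> b / 2 * (e k)\<^sup>2"
    if "e k < R" for k
    using pareto_gap_bounds[OF S mem_S[THEN iffD2, OF that] xbar_S lambar_simplex crit]
    by (simp_all add: \<Phi>_def e_def)
  have err: "a * e k \<le> 2 * norm (v k)" if "e k < R" for k
    using error_bound[OF S mem_S[THEN iffD2, OF that] xbar_S lam xbar_le] by (simp add: e_def v_def)
  have step: "\<rho> * s k * norm (v k) \<le> e k" if "e k < R" for k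
  proof -
    \<comment> \<open>The values at \<open>xbar\<close> also lie below those at the next iterate, so
      the gap at \<open>x k\<close> contains the whole decrease of the step.\<close>
    have "F xbar $ i \<le> F (x k) $ i - \<rho> * s k * (norm (v k))\<^sup>2" for i
      using decrease xbar_le order_trans by blast
    then show ?thesis
      using step_le_error[OF S mem_S[THEN iffD2, OF that] xbar_S lam _ v_def[THEN fun_cong] run_k(2)]
        ab by (simp add: e_def)
  qed

  \<comment> \<open>Trapping the iterates near the limit point\<close>
  \<comment> \<open>By \<open>step\<close>, moving up to \<open>s k / \<delta>\<close> along
    \<open>v k\<close> adds at most \<open>e k / (\<rho> * \<delta>)\<close> to the error, a growth
    by at most the factor \<open>w\<close>.\<close>
  define w where "w = 1 + 1 / (\<rho> * \<delta>)"
  define r0 where "r0 = R / w"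
  have w: "1 < w"
    using \<rho> \<delta> by (simp add: w_def)
  have r0: "0 < r0" "r0 \<le> R" "r0 * w = R"
    using w R by (simp_all add: r0_def pos_divide_le_eq)
  text \<open>The factor \<open>1 / \<delta>\<close> keeps the last rejected trial point in the ball as well.\<close>
  have near: "x k + c *\<^sub>R v k \<in> ball xbar R" if "e k < r0" "0 \<le> c" "c \<le> s k / \<delta>" for k c
  proof -
    have "norm (x k + c *\<^sub>R v k - xbar) \<le> e k + c * norm (v k)"
      using norm_triangle_ineq[of "x k - xbar" "c *\<^sub>R v k"] that(2)
      by (simp add: e_def algebra_simps)
    also have "c * norm (v k) \<le> s k / \<delta> * norm (v k)"
      using that(3) by (intro mult_right_mono) auto
    also have "\<dots> \<le> e k * (1 / (\<rho> * \<delta>))"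
      using step[of k] that(1) r0(2) \<rho> \<delta> by (simp add: field_simps)
    also have "e k + e k * (1 / (\<rho> * \<delta>)) = e k * w"
      by (simp only: w_def distrib_left mult_1_right)
    also have "\<dots> < r0 * w"
      using that(1) w by (intro mult_strict_right_mono) auto
    also have "\<dots> = R"
      by (rule r0(3))
    finally show ?thesis
      by (simp add: dist_norm norm_minus_commute)
  qed
  have s_le: "s k \<le> s k / \<delta>" for k
    using \<delta> s_pos[of k] by (simp add: pos_le_divide_eq)
  have next_S: "x (Suc k) \<in> ball xbar R" if "e k < r0" for k
    unfolding x_Suc using near[OF that _ s_le] s_pos[of k] by simp

  have "\<Phi> \<longlonglongrightarrow> (\<Sum>i\<in>UNIV. lambar $ i * (F xbar $ i - F xbar $ i))"
    unfolding \<Phi>_def by (intro tendsto_intros F_lim)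
  then have \<Phi>_lim: "\<Phi> \<longlonglongrightarrow> 0"
    by simp
  have "0 < a / 2 * r0\<^sup>2"
    using ab r0 by simp
  then obtain K0 where K0: "\<Phi> k < a / 2 * r0\<^sup>2" if "k \<ge> K0" for k
    using order_tendstoD(2)[OF \<Phi>_lim] unfolding eventually_sequentially by blast
  obtain J where "e (r k) < r0" if "k \<ge> J" for k
    using LIMSEQ_D[OF r(2) r0(1)] unfolding e_def o_def by blast
  \<comment> \<open>The subsequence supplies one iterate in the small ball, late enough that the
    merit values are already small.\<close>
  then obtain K where K: "K \<ge> K0" "e K < r0"
    using seq_suble[OF r(1), of "max J K0"] by (meson le_trans max.cobounded1 max.cobounded2)
  have stay: "e k < r0" if "k \<ge> K" for k
    using that
  proof (induction k rule: dec_induct)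
    case base
    show ?case
      by (rule K(2))
  next
    case (step k)
    \<comment> \<open>The next iterate is first known to lie only in the large ball; there the lower
      bound on \<open>\<Phi>\<close> applies and brings it back into the small one.\<close>
    have "a / 2 * (e (Suc k))\<^sup>2 \<le> \<Phi> (Suc k)"
      using next_S[OF step.IH] \<Phi>_lower by (simp only: mem_S)
    also have "\<dots> < a / 2 * r0\<^sup>2"
      using K0 K(1) step.hyps by simp
    finally have "(e (Suc k))\<^sup>2 < r0\<^sup>2"
      using ab by simp
    then show ?case
      by (rule power2_less_imp_less) (use r0(1) in simp)
  qed
  have in_S: "e k < R" "x k \<in> ball xbar R" if "k \<ge> K" for k
    using stay[OF that] r0(2) unfolding mem_S by auto

  \<comment> \<open>Bounds for the scaling parameter and the step length\<close>
  have \<tau>_le: "\<tau> (Suc k) \<le> b" if "k \<ge> K" for k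
  proof -
    have "tau_formula F (lam k) (x k) (x (Suc k)) (v k) (\<tau> k) (t k) \<le> b"
      unfolding x_Suc s_def
      using tau_formula_le[OF S in_S(2)[OF that] _ lam v_def[THEN fun_cong] run_k(2) t_pos \<tau>_pos]
        next_S[OF stay[OF that]] unfolding x_Suc s_def by blast
    \<comment> \<open>The reset value 1 is covered by \<open>1 \<le> b\<close>.\<close>
    with run_k(6)[of k] ab show ?thesis
      by linarith
  qed

  \<comment> \<open>The first entry is for an accepted unit trial \<open>t k = 1\<close>, the second
    for a backtracked step, which is \<delta> times the last rejected one.\<close>
  define c where "c = min (1 / b) (\<delta> * (2 * (1 - \<rho>) / b))"
  have c_pos: "0 < c"
    using ab \<rho> \<delta> by (simp add: c_def)
  \<comment> \<open>The start is \<open>Suc K\<close> because the bound on \<open>\<tau> k\<close>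
    comes from the preceding step.\<close>
  have s_ge: "c \<le> s k" if "k \<ge> Suc K" for k
  proof -
    have k: "k \<ge> K" "\<tau> k \<le> b"
      using that \<tau>_le[of "k - 1"] by auto
    obtain j where j: "t k = \<delta> ^ j"
      using run_k(3)[of k] by (auto simp: armijo_steps_def)
    show ?thesis
    proof (cases j)
      case 0
      then have "1 / b \<le> s k"
        using j k(2) \<tau>_pos[of k] by (simp add: s_def frac_le)
      then show ?thesis
        by (simp add: c_def)
    next
      case (Suc j')
      have tj: "\<delta> ^ j' = t k / \<delta>"
        using j Suc \<delta> by simp
      have "\<delta> ^ j' > t k"
        using tj t_pos[of k] \<delta> by (simp add: pos_less_divide_eq)
      then have "\<delta> ^ j' \<notin> armijo_steps F \<rho> \<delta> (x k) (inverse (\<tau> k) *\<^sub>R v k)"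
        using run_k(4) by fastforce
      then obtain i where rej: "\<not> F (x k + (t k / \<delta>) *\<^sub>R (inverse (\<tau> k) *\<^sub>R v k)) $ i
          \<le> F (x k) $ i + \<rho> * (t k / \<delta>) * psi F (x k) (inverse (\<tau> k) *\<^sub>R v k)"
        unfolding armijo_steps_def tj[symmetric] by auto
      have eq: "t k / \<delta> / \<tau> k = s k / \<delta>"
        by (simp add: s_def)
      have "2 * (1 - \<rho>) / b \<le> t k / \<delta> / \<tau> k"
      proof (rule armijo_rejected_step[OF S in_S(2)[OF k(1)] _ run_k(1) v_def[THEN fun_cong]
            run_k(2) _ \<tau>_pos _ \<rho>(2) rej])
        show "x k + (t k / \<delta> / \<tau> k) *\<^sub>R v k \<in> ball xbar R"
          unfolding eq using near[OF stay[OF k(1)]] s_pos[of k] \<delta> by simp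
      qed (use t_pos[of k] \<delta> ab in auto)
      then have "\<delta> * (2 * (1 - \<rho>) / b) \<le> \<delta> * (s k / \<delta>)"
        unfolding eq using \<delta> by (intro mult_left_mono) auto
      also have "\<dots> = s k"
        using \<delta> by simp
      finally show ?thesis
        by (simp add: c_def)
    qed
  qed

  \<comment> \<open>Contraction of the merit function\<close>
  \<comment> \<open>\<open>err\<close> and \<open>\<Phi>_upper\<close> give
    \<open>(norm (v k))\<^sup>2 \<ge> a\<^sup>2 / (2 * b) * \<Phi> k\<close>, and each step gains at
    least \<open>\<rho> * c\<close> times the left side.\<close>
  define q where "q = 1 - \<rho> * c * (a\<^sup>2 / (2 * b))"
  show ?thesis
  proof (rule R_linear_convergentI)
    fix k assume k: "k \<ge> Suc K"
    then have R_k: "e k < R"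
      using in_S(1)[of k] by simp
    show "(norm (x k - xbar))\<^sup>2 \<le> (2 / a) * \<Phi> k"
      using \<Phi>_lower[OF R_k] ab by (simp add: e_def field_simps)
    have "a\<^sup>2 * (e k)\<^sup>2 \<le> 4 * (norm (v k))\<^sup>2"
      using power_mono[OF err[OF R_k], of 2] ab by (simp add: e_def power_mult_distrib)
    then have "b / 2 * (a\<^sup>2 * (e k)\<^sup>2) \<le> b / 2 * (4 * (norm (v k))\<^sup>2)"
      using ab by (intro mult_left_mono) auto
    moreover have "a\<^sup>2 * \<Phi> k \<le> a\<^sup>2 * (b / 2 * (e k)\<^sup>2)"
      using \<Phi>_upper[OF R_k] by (intro mult_left_mono) auto
    ultimately have "a\<^sup>2 * \<Phi> k \<le> (norm (v k))\<^sup>2 * (2 * b)"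
      by (simp add: algebra_simps)
    then have "a\<^sup>2 / (2 * b) * \<Phi> k \<le> (norm (v k))\<^sup>2"
      using ab by (simp add: pos_divide_le_eq)
    then have "\<rho> * c * (a\<^sup>2 / (2 * b) * \<Phi> k) \<le> \<rho> * c * (norm (v k))\<^sup>2"
      using \<rho> c_pos by (intro mult_left_mono) auto
    also have "\<dots> \<le> \<rho> * s k * (norm (v k))\<^sup>2"
      using \<rho> s_ge[OF k] by (intro mult_right_mono mult_left_mono) auto
    finally have "\<rho> * c * (a\<^sup>2 / (2 * b) * \<Phi> k) \<le> \<rho> * s k * (norm (v k))\<^sup>2" .
    moreover have "\<Phi> (Suc k) \<le> \<Phi> k - \<rho> * s k * (norm (v k))\<^sup>2"
    proof -
      \<comment> \<open>The guaranteed decrease is the same in all components, so averaging with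
        \<open>lambar\<close> preserves it.\<close>
      have "\<Phi> (Suc k) \<le> (\<Sum>i\<in>UNIV. lambar $ i *
          (F (x k) $ i - F xbar $ i - \<rho> * s k * (norm (v k))\<^sup>2))"
        unfolding \<Phi>_def using decrease[of k]
        by (intro prob_simplex_sum_mono[OF lambar_simplex]) (simp add: algebra_simps)
      also have "\<dots> = \<Phi> k - (\<Sum>i\<in>UNIV. lambar $ i * (\<rho> * s k * (norm (v k))\<^sup>2))"
        unfolding \<Phi>_def by (simp only: right_diff_distrib sum_subtractf)
      finally show ?thesis
        unfolding prob_simplex_sum_const[OF lambar_simplex] .
    qed
    ultimately show "\<Phi> (Suc k) \<le> q * \<Phi> k"
      by (simp add: q_def algebra_simps)
  next
    show "q < 1"
      using \<rho> c_pos ab by (simp add: q_def)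
    show "0 < 2 / a"
      using ab by simp
  qed
qed

end
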